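(* Let $\mathbb{T}$ be a semi-abelian theory with unique constant $e$, let $H$ be a groupoid and let $G$ be an internal groupoid in $\mathsf{Set}^{\mathbb{T}}$ whose underlying groupoid is transitive. Suppose that $p\colon H\to G$ is a covering morphism of underlying groupoids, that $e'\in\mathsf{Ob}(H)$ satisfies $p(e')=e$, and that the characteristic group $C$ of $p$ at $e'$ is a sub $\mathbb{T}$-algebra of $G(e)$. Then the $\mathbb{T}$-algebraic structure of $G$ lifts to $H$.
   Context: An algebraic theory (in the sense of Lawvere) $\mathbb{T}$ is a category with objects $T^0,T,T^2,T^3,\dots$, where $T^n$ is the $n$-fold product of a distinguished object $T$ with itself, with chosen projections. Morphisms $T^n\to T$ are called $n$-ary operations; $0$-ary operations are called constants. A $\mathbb{T}$-algebra is a product-preserving functor $\mathbb{T}\to\mathsf{Set}$; equivalently, a set $A$ with a map $\tau=\tau_A\colon A^n\to A$ for each $n$-ary operation $\tau$, compatible with composition and projections in $\mathbb{T}$. A $\mathbb{T}$-homomorphism is a map commuting with all operations; a sub $\mathbb{T}$-algebra is a subset closed under all operations. The category of $\mathbb{T}$-algebras is $\mathsf{Set}^{\mathbb{T}}$. The theory $\mathbb{T}$ is called semi-abelian if $\mathsf{Set}^{\mathbb{T}}$ is a semi-abelian category (Barr-exact, protomodular, with finite coproducts and a zero object); equivalently (Bourn--Janelidze), $\mathbb{T}$ has a unique constant $e$ and, for some natural number $n$, has binary operations $\alpha_1,\dots,\alpha_n$ with $\alpha_i(X,X)=e$ and an $(n+1)$-ary operation $\theta$ with $\theta(\alpha_1(X,Y),\dots,\alpha_n(X,Y),Y)=X$.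 The element of a $\mathbb{T}$-algebra given by the constant is also denoted $e$; in particular $e\in\mathsf{Ob}(G)$. In a groupoid $G$ (the arrow set also denoted $G$) with source and target maps $s,t$, the composite $g\circ h$ is defined when $t(g)=s(h)$. $G(x,y)$ is the set of arrows from $x$ to $y$, $G(x)=G(x,x)$ is the object group at $x$, and $\mathsf{St}_G x=\{g\in G:s(g)=x\}$. $G$ is transitive if $G(x,y)\neq\emptyset$ for all objects $x,y$. An internal groupoid in $\mathsf{Set}^{\mathbb{T}}$ is a groupoid $G$ such that $\mathsf{Ob}(G)$ and $G$ are $\mathbb{T}$-algebras and the source, target, identity, partial composition and inversion maps are $\mathbb{T}$-homomorphisms; then $G(e)$ is a sub $\mathbb{T}$-algebra of $G$. A morphism of internal groupoids is a groupoid morphism (functor) that is a $\mathbb{T}$-homomorphism on objects and on arrows. A groupoid morphism $p\colon H\to G$ is a covering morphism if for each $\tilde x\in\mathsf{Ob}(H)$ the restriction $\mathsf{St}_H\tilde x\to\mathsf{St}_G p(\tilde x)$ is bijective. The characteristic group of $p$ at $\tilde x\in\mathsf{Ob}(H)$ is the subgroup $p(H(\tilde x))$ of $G(p(\tilde x))$. Given a covering morphism of groupoids $p\colon H\to G$, where $H$ is a groupoid and $G$ is an internal groupoid in $\mathsf{Set}^{\mathbb{T}}$, one says that the $\mathbb{T}$-algebraic structure of $G$ lifts to $H$ if $H$ becomes an internal groupoid in $\mathsf{Set}^{\mathbb{T}}$ such that $p$ is a morphism of internal groupoids.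
   Formalization: The groupoid H is additionally assumed transitive; without this the claim fails, e.g. for F_2-vector spaces, G the trivial one-object groupoid and H discrete on three objects, since a three-element set carries no F_2-vector space structure. *)

theory Defs
  imports Main
begin

section \<open>Algebraic theories in the sense of Lawvere\<close>

text \<open>The object \<open>T\<^sup>n\<close> is represented by its exponent \<open>n\<close>. Composition is written in functional order:
  \<open>compose T g f\<close> is ``\<open>g\<close> after \<open>f\<close>''. Projections are numbered from 0.
  The object \<open>T\<^sup>1\<close> is \<open>T\<close> itself, with the identity as its projection.\<close>

record 'm theory_data =
  mor :: "'m set"
  dm :: "'m \<Rightarrow> nat"
  cd :: "'m \<Rightarrow> nat"
  ident :: "nat \<Rightarrow> 'm"
  compose :: "'m \<Rightarrow> 'm \<Rightarrow> 'm"
  proj :: "nat \<Rightarrow> nat \<Rightarrow> 'm"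

definition hom_set :: "'m theory_data \<Rightarrow> nat \<Rightarrow> nat \<Rightarrow> 'm set" where
  "hom_set T m n = {f \<in> mor T. dm T f = m \<and> cd T f = n}"

locale algebraic_theory =
  fixes T :: "'m theory_data"
  assumes ident_hom: "ident T n \<in> hom_set T n n"
    and compose_hom: "\<lbrakk>f \<in> hom_set T l m; g \<in> hom_set T m n\<rbrakk> \<Longrightarrow> compose T g f \<in> hom_set T l n"
    and compose_ident_left: "f \<in> hom_set T m n \<Longrightarrow> compose T (ident T n) f = f"
    and compose_ident_right: "f \<in> hom_set T m n \<Longrightarrow> compose T f (ident T m) = f"
    and compose_assoc: "\<lbrakk>f \<in> hom_set T k l; g \<in> hom_set T l m; h \<in> hom_set T m n\<rbrakk>
          \<Longrightarrow> compose T h (compose T g f) = compose T (compose T h g) f"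
    and proj_hom: "i < n \<Longrightarrow> proj T n i \<in> hom_set T n 1"
    and proj_single: "proj T 1 0 = ident T 1"
    and product_universal: "set fs \<subseteq> hom_set T m 1 \<Longrightarrow>
          \<exists>!f. f \<in> hom_set T m (length fs) \<and>
               (\<forall>i<length fs. compose T (proj T (length fs) i) f = fs ! i)"

definition tupling :: "'m theory_data \<Rightarrow> nat \<Rightarrow> 'm list \<Rightarrow> 'm" where
  "tupling T m fs = (THE f. f \<in> hom_set T m (length fs) \<and>
      (\<forall>i<length fs. compose T (proj T (length fs) i) f = fs ! i))"

definition operations :: "'m theory_data \<Rightarrow> nat \<Rightarrow> 'm set" where
  "operations T n = hom_set T n 1"

abbreviation constants :: "'m theory_data \<Rightarrow> 'm set" where
  "constants T \<equiv> operations T 0"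

text \<open>The description of semi-abelian theories due to Bourn and Janelidze. The last two conjuncts
  are the identities \<open>\<alpha>\<^sub>i(X,X) = e\<close>, between morphisms \<open>T \<rightarrow> T\<close>, and
  \<open>\<theta>(\<alpha>\<^sub>1(X,Y),\<dots>,\<alpha>\<^sub>n(X,Y),Y) = X\<close>, between morphisms \<open>T\<^sup>2 \<rightarrow> T\<close>, where \<open>n\<close> is the length of the
  list \<open>\<alpha>s\<close>; \<open>tupling T 1 []\<close> is the unique morphism \<open>T \<rightarrow> T\<^sup>0\<close>.\<close>

locale semi_abelian_theory = algebraic_theory T for T :: "'m theory_data" +
  assumes bourn_janelidze: "\<exists>e \<alpha>s \<theta>. constants T = {e} \<and>
      set \<alpha>s \<subseteq> operations T 2 \<and> \<theta> \<in> operations T (length \<alpha>s + 1) \<and>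
      (\<forall>\<alpha>\<in>set \<alpha>s. compose T \<alpha> (tupling T 1 [ident T 1, ident T 1]) = compose T e (tupling T 1 [])) \<and>
      compose T \<theta> (tupling T 2 (\<alpha>s @ [proj T 2 1])) = proj T 2 0"


section \<open>Algebras and homomorphisms\<close>

text \<open>Elements of \<open>A\<^sup>n\<close> are lists of length \<open>n\<close>. A structure on \<open>A\<close> is a function \<open>act\<close> sending an
  \<open>n\<close>-ary operation \<open>\<tau>\<close> to \<open>\<tau>\<^sub>A : A\<^sup>n \<rightarrow> A\<close>; its values elsewhere are irrelevant.\<close>

definition tuples :: "'a set \<Rightarrow> nat \<Rightarrow> 'a list set" where
  "tuples A n = {xs. set xs \<subseteq> A \<and> length xs = n}"

locale t_algebra =
  fixes T :: "'m theory_data" and A :: "'a set" and act :: "'m \<Rightarrow> 'a list \<Rightarrow> 'a"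
  assumes act_closed: "\<lbrakk>\<tau> \<in> operations T n; xs \<in> tuples A n\<rbrakk> \<Longrightarrow> act \<tau> xs \<in> A"
    and act_proj: "\<lbrakk>i < n; xs \<in> tuples A n\<rbrakk> \<Longrightarrow> act (proj T n i) xs = xs ! i"
    and act_compose: "\<lbrakk>\<tau> \<in> operations T n; f \<in> hom_set T m n; xs \<in> tuples A m\<rbrakk> \<Longrightarrow>
          act (compose T \<tau> f) xs = act \<tau> (map (\<lambda>i. act (compose T (proj T n i) f) xs) [0..<n])"

definition subalgebra :: "'m theory_data \<Rightarrow> ('m \<Rightarrow> 'a list \<Rightarrow> 'a) \<Rightarrow> 'a set \<Rightarrow> 'a set \<Rightarrow> bool" where
  "subalgebra T act B A \<longleftrightarrow> B \<subseteq> A \<and>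
     (\<forall>n. \<forall>\<tau>\<in>operations T n. \<forall>xs\<in>tuples B n. act \<tau> xs \<in> B)"

definition t_homomorphism :: "'m theory_data \<Rightarrow> 'a set \<Rightarrow> ('m \<Rightarrow> 'a list \<Rightarrow> 'a) \<Rightarrow>
    'b set \<Rightarrow> ('m \<Rightarrow> 'b list \<Rightarrow> 'b) \<Rightarrow> ('a \<Rightarrow> 'b) \<Rightarrow> bool" where
  "t_homomorphism T A actA B actB f \<longleftrightarrow> f ` A \<subseteq> B \<and>
     (\<forall>n. \<forall>\<tau>\<in>operations T n. \<forall>xs\<in>tuples A n. f (actA \<tau> xs) = actB \<tau> (map f xs))"

definition prod_act :: "('m \<Rightarrow> 'a list \<Rightarrow> 'a) \<Rightarrow> ('m \<Rightarrow> 'b list \<Rightarrow> 'b) \<Rightarrow>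
    'm \<Rightarrow> ('a \<times> 'b) list \<Rightarrow> 'a \<times> 'b" where
  "prod_act actA actB \<tau> xs = (actA \<tau> (map fst xs), actB \<tau> (map snd xs))"


section \<open>Groupoids\<close>

text \<open>\<open>cmp G g h\<close> is the composite \<open>g \<circ> h\<close> in diagrammatic order, defined when \<open>t(g) = s(h)\<close>.\<close>

record ('o, 'a) groupoid_data =
  ob :: "'o set"
  arr :: "'a set"
  src :: "'a \<Rightarrow> 'o"
  tgt :: "'a \<Rightarrow> 'o"
  idn :: "'o \<Rightarrow> 'a"
  cmp :: "'a \<Rightarrow> 'a \<Rightarrow> 'a"
  ivs :: "'a \<Rightarrow> 'a"

definition arrows :: "('o, 'a) groupoid_data \<Rightarrow> 'o \<Rightarrow> 'o \<Rightarrow> 'a set" where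
  "arrows G x y = {g \<in> arr G. src G g = x \<and> tgt G g = y}"

abbreviation object_group :: "('o, 'a) groupoid_data \<Rightarrow> 'o \<Rightarrow> 'a set" where
  "object_group G x \<equiv> arrows G x x"

definition star :: "('o, 'a) groupoid_data \<Rightarrow> 'o \<Rightarrow> 'a set" where
  "star G x = {g \<in> arr G. src G g = x}"

definition composable :: "('o, 'a) groupoid_data \<Rightarrow> ('a \<times> 'a) set" where
  "composable G = {(g, h). g \<in> arr G \<and> h \<in> arr G \<and> tgt G g = src G h}"

locale groupoid =
  fixes G :: "('o, 'a) groupoid_data"
  assumes src_ob: "g \<in> arr G \<Longrightarrow> src G g \<in> ob G"
    and tgt_ob: "g \<in> arr G \<Longrightarrow> tgt G g \<in> ob G"
    and idn_arrows: "x \<in> ob G \<Longrightarrow> idn G x \<in> arrows G x x"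
    and cmp_arrows: "\<lbrakk>g \<in> arrows G x y; h \<in> arrows G y z\<rbrakk> \<Longrightarrow> cmp G g h \<in> arrows G x z"
    and cmp_assoc: "\<lbrakk>g \<in> arrows G w x; h \<in> arrows G x y; k \<in> arrows G y z\<rbrakk>
          \<Longrightarrow> cmp G (cmp G g h) k = cmp G g (cmp G h k)"
    and cmp_idn_left: "g \<in> arrows G x y \<Longrightarrow> cmp G (idn G x) g = g"
    and cmp_idn_right: "g \<in> arrows G x y \<Longrightarrow> cmp G g (idn G y) = g"
    and ivs_arrows: "g \<in> arrows G x y \<Longrightarrow> ivs G g \<in> arrows G y x"
    and cmp_ivs_right: "g \<in> arrows G x y \<Longrightarrow> cmp G g (ivs G g) = idn G x"
    and cmp_ivs_left: "g \<in> arrows G x y \<Longrightarrow> cmp G (ivs G g) g = idn G y"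

definition transitive_groupoid :: "('o, 'a) groupoid_data \<Rightarrow> bool" where
  "transitive_groupoid G \<longleftrightarrow> groupoid G \<and> (\<forall>x\<in>ob G. \<forall>y\<in>ob G. arrows G x y \<noteq> {})"

text \<open>A morphism is given by its object map \<open>pO\<close> and its arrow map \<open>pA\<close>.\<close>

definition groupoid_morphism :: "('p, 'b) groupoid_data \<Rightarrow> ('o, 'a) groupoid_data \<Rightarrow>
    ('p \<Rightarrow> 'o) \<Rightarrow> ('b \<Rightarrow> 'a) \<Rightarrow> bool" where
  "groupoid_morphism H G pO pA \<longleftrightarrow> groupoid H \<and> groupoid G \<and>
     pO ` ob H \<subseteq> ob G \<and> pA ` arr H \<subseteq> arr G \<and>
     (\<forall>h\<in>arr H. src G (pA h) = pO (src H h) \<and> tgt G (pA h) = pO (tgt H h)) \<and>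
     (\<forall>x\<in>ob H. pA (idn H x) = idn G (pO x)) \<and>
     (\<forall>(g, h)\<in>composable H. pA (cmp H g h) = cmp G (pA g) (pA h))"

definition covering_morphism :: "('p, 'b) groupoid_data \<Rightarrow> ('o, 'a) groupoid_data \<Rightarrow>
    ('p \<Rightarrow> 'o) \<Rightarrow> ('b \<Rightarrow> 'a) \<Rightarrow> bool" where
  "covering_morphism H G pO pA \<longleftrightarrow> groupoid_morphism H G pO pA \<and>
     (\<forall>x\<in>ob H. bij_betw pA (star H x) (star G (pO x)))"

definition characteristic_group :: "('p, 'b) groupoid_data \<Rightarrow> ('b \<Rightarrow> 'a) \<Rightarrow> 'p \<Rightarrow> 'a set" where
  "characteristic_group H pA x = pA ` object_group H x"


section \<open>Internal groupoids\<close>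

text \<open>\<open>actO\<close> and \<open>actA\<close> are the algebra structures on objects and on arrows. The domain of the
  partial composition carries the structure induced from the product \<open>G \<times> G\<close>.\<close>

locale internal_groupoid =
  groupoid G + objects: t_algebra T "ob G" actO + arrows: t_algebra T "arr G" actA
  for T :: "'m theory_data" and G :: "('o, 'a) groupoid_data"
    and actO :: "'m \<Rightarrow> 'o list \<Rightarrow> 'o" and actA :: "'m \<Rightarrow> 'a list \<Rightarrow> 'a" +
  assumes src_hom: "t_homomorphism T (arr G) actA (ob G) actO (src G)"
    and tgt_hom: "t_homomorphism T (arr G) actA (ob G) actO (tgt G)"
    and idn_hom: "t_homomorphism T (ob G) actO (arr G) actA (idn G)"
    and cmp_hom: "t_homomorphism T (composable G) (prod_act actA actA) (arr G) actA (\<lambda>(g, h). cmp G g h)"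
    and ivs_hom: "t_homomorphism T (arr G) actA (arr G) actA (ivs G)"

definition internal_groupoid_morphism :: "'m theory_data \<Rightarrow>
    ('p, 'b) groupoid_data \<Rightarrow> ('m \<Rightarrow> 'p list \<Rightarrow> 'p) \<Rightarrow> ('m \<Rightarrow> 'b list \<Rightarrow> 'b) \<Rightarrow>
    ('o, 'a) groupoid_data \<Rightarrow> ('m \<Rightarrow> 'o list \<Rightarrow> 'o) \<Rightarrow> ('m \<Rightarrow> 'a list \<Rightarrow> 'a) \<Rightarrow>
    ('p \<Rightarrow> 'o) \<Rightarrow> ('b \<Rightarrow> 'a) \<Rightarrow> bool" where
  "internal_groupoid_morphism T H hactO hactA G gactO gactA pO pA \<longleftrightarrow>
     internal_groupoid T H hactO hactA \<and> internal_groupoid T G gactO gactA \<and>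
     groupoid_morphism H G pO pA \<and>
     t_homomorphism T (ob H) hactO (ob G) gactO pO \<and>
     t_homomorphism T (arr H) hactA (arr G) gactA pA"

definition structure_lifts :: "'m theory_data \<Rightarrow> ('p, 'b) groupoid_data \<Rightarrow>
    ('o, 'a) groupoid_data \<Rightarrow> ('m \<Rightarrow> 'o list \<Rightarrow> 'o) \<Rightarrow> ('m \<Rightarrow> 'a list \<Rightarrow> 'a) \<Rightarrow>
    ('p \<Rightarrow> 'o) \<Rightarrow> ('b \<Rightarrow> 'a) \<Rightarrow> bool" where
  "structure_lifts T H G actO actA pO pA \<longleftrightarrow>
     (\<exists>hactO hactA. internal_groupoid T H hactO hactA \<and>
        internal_groupoid_morphism T H hactO hactA G actO actA pO pA)"

end

theory Submission
  imports Defs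
begin

text \<open>
  As \<open>H\<close> is transitive, its objects are the endpoints of the arrows out of \<open>e'\<close>, and a covering
  morphism identifies these arrows with the arrows of \<open>G\<close> out of \<open>e\<close>. Thus \<open>Ob(H)\<close> is the set of cosets \<open>C g\<close>
  with \<open>g \<in> St\<^sub>G e\<close>, where \<open>C\<close> is the characteristic group at \<open>e'\<close>. As \<open>e\<close> is the only constant,
  \<open>\<tau>(e,\<dots>,e) = e\<close> for every operation \<open>\<tau>\<close>, so \<open>St\<^sub>G e\<close> is closed under the operations and one can
  try to put \<open>\<tau>(C g\<^sub>1,\<dots>,C g\<^sub>n) = C \<tau>(g\<^sub>1,\<dots>,g\<^sub>n)\<close>. Composition in \<open>G\<close> is a homomorphism, whence
  \<open>\<tau>(c\<^sub>1 g\<^sub>1,\<dots>,c\<^sub>n g\<^sub>n) = \<tau>(c\<^sub>1,\<dots>,c\<^sub>n) \<tau>(g\<^sub>1,\<dots>,g\<^sub>n)\<close>, and since \<open>C\<close> is a subalgebra the first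
  factor lies in \<open>C\<close>: the operation is well defined (lemma \<open>lift_obj_act_tgt\<close>).

  An arrow of \<open>H\<close> is determined by its source and its image in \<open>G\<close> (lemma \<open>arrow_eqI\<close>), so an
  operation on arrows is forced: \<open>\<tau>(h\<^sub>1,\<dots>,h\<^sub>n)\<close> is the lift of \<open>\<tau>(p h\<^sub>1,\<dots>,p h\<^sub>n)\<close> starting at
  \<open>\<tau>(s h\<^sub>1,\<dots>,s h\<^sub>n)\<close>. Every identity between arrows that is required of an internal groupoid is then
  checked on sources, where it is an identity in \<open>Ob(H)\<close>, and on images, where it holds in \<open>G\<close>.
  Only the compatibility with targets needs an argument of its own (lemma \<open>tgt_lift_arr_act\<close>).
\<close>

section \<open>Operations, tuples and internal composition\<close>

lemma tuples_map:
  assumes "xs \<in> tuples A n" and "\<And>x. x \<in> A \<Longrightarrow> f x \<in> B"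
  shows "map f xs \<in> tuples B n"
  using assms by (auto simp: tuples_def)

lemma t_homomorphismD:
  assumes "t_homomorphism T A actA B actB f" and "\<tau> \<in> operations T n" and "xs \<in> tuples A n"
  shows "f (actA \<tau> xs) = actB \<tau> (map f xs)"
  using assms by (simp add: t_homomorphism_def)

text \<open>The tuple \<open>(e,\<dots>,e)\<close> is itself the value of a morphism \<open>T\<^sup>0 \<rightarrow> T\<^sup>n\<close>, so applying \<open>\<tau>\<close> to it
  gives the value of a constant, and there is only one.\<close>

lemma (in algebraic_theory) act_replicate_constant:
  assumes alg: "t_algebra T A act" and const: "constants T = {e}" and \<tau>: "\<tau> \<in> operations T n"
  shows "act \<tau> (replicate n (act e [])) = act e []"
proof -
  interpret t_algebra T A act by (rule alg)
  have e: "e \<in> hom_set T 0 1"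
    using const unfolding operations_def by blast
  have "set (replicate n e) \<subseteq> hom_set T 0 1"
  proof
    fix x assume "x \<in> set (replicate n e)"
    then have "x = e"
      by simp
    then show "x \<in> hom_set T 0 1"
      using e by (simp only:)
  qed
  from ex1_implies_ex[OF product_universal[OF this]]
  obtain f where "f \<in> hom_set T 0 (length (replicate n e))"
    by (elim exE conjE)
  then have f: "f \<in> hom_set T 0 n"
    by (simp only: length_replicate)
  have nil: "[] \<in> tuples A 0"
    by (simp add: tuples_def)
  have "compose T \<tau> f \<in> constants T"
    using compose_hom[OF f] \<tau> by (simp add: operations_def)
  then have "act e [] = act (compose T \<tau> f) []"
    using const by simp
  also have "\<dots> = act \<tau> (map (\<lambda>i. act (compose T (proj T n i) f) []) [0..<n])"
    by (rule act_compose[OF \<tau> f nil])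
  also have "map (\<lambda>i. act (compose T (proj T n i) f) []) [0..<n] = map (\<lambda>i. act e []) [0..<n]"
  proof (rule map_cong[OF refl])
    fix i assume "i \<in> set [0..<n]"
    then have "compose T (proj T n i) f \<in> constants T"
      using compose_hom[OF f proj_hom] by (simp add: operations_def)
    then show "act (compose T (proj T n i) f) [] = act e []"
      using const by simp
  qed
  also have "\<dots> = replicate n (act e [])"
    by (simp add: map_replicate_const)
  finally show ?thesis by (rule sym)
qed

text \<open>The interchange law. It is stated for lists \<open>map a zs\<close> and \<open>map b zs\<close> over a common index list,
  so that no reasoning about zipped lists is needed where it is used.\<close>

lemma (in internal_groupoid) act_cmp:
  assumes \<tau>: "\<tau> \<in> operations T n" and zs: "length zs = n"
    and comp: "\<And>z. z \<in> set zs \<Longrightarrow> (a z, b z) \<in> composable G"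
  shows "actA \<tau> (map (\<lambda>z. cmp G (a z) (b z)) zs) = cmp G (actA \<tau> (map a zs)) (actA \<tau> (map b zs))"
proof -
  have "map (\<lambda>z. (a z, b z)) zs \<in> tuples (composable G) n"
    using zs comp by (auto simp: tuples_def)
  from t_homomorphismD[OF cmp_hom \<tau> this] show ?thesis
    by (simp add: prod_act_def comp_def)
qed

lemma (in internal_groupoid)
  assumes "\<tau> \<in> operations T n" and "gs \<in> tuples (arr G) n"
  shows src_act: "src G (actA \<tau> gs) = actO \<tau> (map (src G) gs)"
    and tgt_act: "tgt G (actA \<tau> gs) = actO \<tau> (map (tgt G) gs)"
    and ivs_act: "ivs G (actA \<tau> gs) = actA \<tau> (map (ivs G) gs)"
  by (rule t_homomorphismD[OF src_hom assms] t_homomorphismD[OF tgt_hom assms]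
      t_homomorphismD[OF ivs_hom assms])+

lemma (in internal_groupoid) idn_act:
  assumes "\<tau> \<in> operations T n" and "xs \<in> tuples (ob G) n"
  shows "idn G (actO \<tau> xs) = actA \<tau> (map (idn G) xs)"
  by (rule t_homomorphismD[OF idn_hom assms])


section \<open>Arrows of a groupoid\<close>

context groupoid
begin

lemma idn_arr:
  assumes "x \<in> ob G"
  shows "idn G x \<in> arr G" "src G (idn G x) = x" "tgt G (idn G x) = x"
  using idn_arrows[OF assms] by (auto simp: arrows_def)

lemma cmp_arr:
  assumes "g \<in> arr G" "h \<in> arr G" "tgt G g = src G h"
  shows "cmp G g h \<in> arr G" "src G (cmp G g h) = src G g" "tgt G (cmp G g h) = tgt G h"
  using cmp_arrows[of g "src G g" "tgt G g" h "tgt G h"] assms by (auto simp: arrows_def)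

lemma ivs_arr:
  assumes "g \<in> arr G"
  shows "ivs G g \<in> arr G" "src G (ivs G g) = tgt G g" "tgt G (ivs G g) = src G g"
  using ivs_arrows[of g "src G g" "tgt G g"] assms by (auto simp: arrows_def)

lemma cmp_ivs_cancel_right:
  assumes "g \<in> arr G" "h \<in> arr G" "tgt G g = tgt G h"
  shows "cmp G (cmp G g (ivs G h)) h = g"
proof -
  have "cmp G (cmp G g (ivs G h)) h = cmp G g (cmp G (ivs G h) h)"
    using assms ivs_arr[of h]
    by (intro cmp_assoc[of g "src G g" "tgt G g" _ "src G h" _ "tgt G h"]) (auto simp: arrows_def)
  also have "cmp G (ivs G h) h = idn G (tgt G g)"
    using cmp_ivs_left[of h "src G h" "tgt G h"] assms by (simp add: arrows_def)
  also have "cmp G g (idn G (tgt G g)) = g"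
    using cmp_idn_right[of g "src G g" "tgt G g"] assms by (simp add: arrows_def)
  finally show ?thesis .
qed

lemma ivs_unique:
  assumes "g \<in> arr G" "k \<in> arr G" "src G k = tgt G g" "cmp G k g = idn G (tgt G g)"
    and "tgt G k = src G g"
  shows "k = ivs G g"
proof -
  have "k = cmp G k (cmp G g (ivs G g))"
    using cmp_idn_right[of k "src G k" "tgt G k"] cmp_ivs_right[of g "src G g" "tgt G g"] assms
    by (simp add: arrows_def)
  also have "\<dots> = cmp G (cmp G k g) (ivs G g)"
    using assms ivs_arr[of g]
    by (intro cmp_assoc[of k "src G k" "src G g" _ "tgt G g" _ "src G g", symmetric])
      (auto simp: arrows_def)
  also have "\<dots> = ivs G g"
    using cmp_idn_left[of "ivs G g" "tgt G g" "src G g"] ivs_arr[of g] assms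
    by (simp add: arrows_def)
  finally show ?thesis .
qed

end


section \<open>Lifting arrows along the covering\<close>

locale pointed_covering =
  algebraic_theory T + G: internal_groupoid T G actO actA + H: groupoid H
  for T :: "'m theory_data"
    and G :: "('o, 'a) groupoid_data" and actO :: "'m \<Rightarrow> 'o list \<Rightarrow> 'o"
    and actA :: "'m \<Rightarrow> 'a list \<Rightarrow> 'a"
    and H :: "('p, 'b) groupoid_data" +
  fixes pO :: "'p \<Rightarrow> 'o" and pA :: "'b \<Rightarrow> 'a" and e :: 'm and e' :: 'p
  assumes unique_constant: "constants T = {e}"
    and covering: "covering_morphism H G pO pA"
    and base_ob: "e' \<in> ob H" and base_over: "pO e' = actO e []"
    and reachable: "x \<in> ob H \<Longrightarrow> arrows H e' x \<noteq> {}"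
    and char_subalgebra:
      "subalgebra T actA (characteristic_group H pA e') (object_group G (actO e []))"
begin

lemma morphism: "groupoid_morphism H G pO pA"
  using covering by (simp add: covering_morphism_def)

lemma pO_ob: "x \<in> ob H \<Longrightarrow> pO x \<in> ob G"
  using morphism by (auto simp: groupoid_morphism_def)

lemma pA_arr:
  assumes "h \<in> arr H"
  shows "pA h \<in> arr G" "src G (pA h) = pO (src H h)" "tgt G (pA h) = pO (tgt H h)"
  using morphism assms by (auto simp: groupoid_morphism_def)

lemma pA_idn: "x \<in> ob H \<Longrightarrow> pA (idn H x) = idn G (pO x)"
  using morphism by (auto simp: groupoid_morphism_def)

lemma pA_cmp:
  assumes "g \<in> arr H" "h \<in> arr H" "tgt H g = src H h"
  shows "pA (cmp H g h) = cmp G (pA g) (pA h)"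
  using morphism assms by (auto simp: groupoid_morphism_def composable_def)

lemma pA_ivs:
  assumes "h \<in> arr H"
  shows "pA (ivs H h) = ivs G (pA h)"
proof (rule G.ivs_unique)
  have "cmp G (pA (ivs H h)) (pA h) = pA (cmp H (ivs H h) h)"
    using assms H.ivs_arr[OF assms] by (simp add: pA_cmp)
  also have "\<dots> = idn G (tgt G (pA h))"
    using assms H.cmp_ivs_left[of h "src H h" "tgt H h"]
    by (simp add: arrows_def pA_arr pA_idn H.tgt_ob)
  finally show "cmp G (pA (ivs H h)) (pA h) = idn G (tgt G (pA h))" .
qed (use assms H.ivs_arr[OF assms] in \<open>simp_all add: pA_arr\<close>)

lemma arrow_eqI:
  assumes "h \<in> arr H" "k \<in> arr H" "src H h = src H k" "pA h = pA k"
  shows "h = k"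
proof -
  have "inj_on pA (star H (src H k))"
    using covering assms H.src_ob by (auto simp: covering_morphism_def bij_betw_def)
  then show ?thesis
    using assms by (auto simp: star_def dest: inj_onD)
qed

definition lift :: "'p \<Rightarrow> 'a \<Rightarrow> 'b" where
  "lift x g = inv_into (star H x) pA g"

lemma lift:
  assumes "x \<in> ob H" "g \<in> arr G" "src G g = pO x"
  shows "lift x g \<in> arr H" "src H (lift x g) = x" "pA (lift x g) = g"
    "tgt H (lift x g) \<in> ob H" "pO (tgt H (lift x g)) = tgt G g"
proof -
  have im: "g \<in> pA ` star H x"
    using covering assms by (auto simp: covering_morphism_def bij_betw_def star_def)
  from inv_into_into[OF im] show l: "lift x g \<in> arr H" "src H (lift x g) = x"
    by (auto simp: lift_def star_def)
  from f_inv_into_f[OF im] show p: "pA (lift x g) = g"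
    by (simp add: lift_def)
  show "tgt H (lift x g) \<in> ob H" "pO (tgt H (lift x g)) = tgt G g"
    using l(1) H.tgt_ob pA_arr(3)[OF l(1)] p by auto
qed

lemma lift_eqI:
  assumes "h \<in> arr H" "src H h = x" "pA h = g"
  shows "lift x g = h"
proof -
  have "x \<in> ob H" "g \<in> arr G" "src G g = pO x"
    using H.src_ob[OF assms(1)] pA_arr[OF assms(1)] assms(2,3) by simp_all
  note l = lift[OF this]
  show ?thesis
    by (rule arrow_eqI[OF l(1) assms(1)]) (simp_all only: l assms)
qed

lemma lift_cmp:
  assumes "x \<in> ob H" "g \<in> arr G" "src G g = pO x" "k \<in> arr G" "src G k = tgt G g"
  shows "lift x (cmp G g k) = cmp H (lift x g) (lift (tgt H (lift x g)) k)"
proof -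
  note l = lift[OF assms(1-3)]
  have "src G k = pO (tgt H (lift x g))"
    by (simp only: l assms(5))
  note m = lift[OF l(4) assms(4) this]
  show ?thesis
    by (rule lift_eqI) (simp_all only: H.cmp_arr pA_cmp l m)
qed


section \<open>The algebra of objects\<close>

lemma star_base_src: "h \<in> star H e' \<Longrightarrow> src G (pA h) = actO e []"
  by (auto simp: star_def pA_arr base_over)

lemma star_base_images:
  assumes "hs \<in> tuples (star H e') n"
  shows "map pA hs \<in> tuples (arr G) n"
  using assms by (rule tuples_map) (simp add: star_def pA_arr)

text \<open>The star of \<open>G\<close> at \<open>e\<close> is closed under the operations, so their values can be lifted to arrows
  starting at \<open>e'\<close>.\<close>

lemma act_star_base:
  assumes \<tau>: "\<tau> \<in> operations T n" and hs: "hs \<in> tuples (star H e') n"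
  shows "actA \<tau> (map pA hs) \<in> arr G" "src G (actA \<tau> (map pA hs)) = pO e'"
proof -
  note im = star_base_images[OF hs]
  show "actA \<tau> (map pA hs) \<in> arr G"
    by (rule G.arrows.act_closed[OF \<tau> im])
  have "src G (actA \<tau> (map pA hs)) = actO \<tau> (map (src G) (map pA hs))"
    by (rule G.src_act[OF \<tau> im])
  also have "map (src G) (map pA hs) = replicate n (actO e [])"
  proof (rule replicate_eqI)
    show "length (map (src G) (map pA hs)) = n"
      using hs by (simp add: tuples_def)
    fix x assume "x \<in> set (map (src G) (map pA hs))"
    then obtain h where "h \<in> set hs" "x = src G (pA h)"
      by auto
    then show "x = actO e []"
      using hs star_base_src unfolding tuples_def by blast
  qed
  also have "actO \<tau> \<dots> = actO e []"
    by (rule act_replicate_constant[OF G.objects.t_algebra_axioms unique_constant \<tau>])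
  finally show "src G (actA \<tau> (map pA hs)) = pO e'"
    unfolding base_over .
qed

lemma lift_star_base:
  assumes "\<tau> \<in> operations T n" and "hs \<in> tuples (star H e') n"
  shows "lift e' (actA \<tau> (map pA hs)) \<in> star H e'"
    "pA (lift e' (actA \<tau> (map pA hs))) = actA \<tau> (map pA hs)"
    "tgt H (lift e' (actA \<tau> (map pA hs))) \<in> ob H"
    "pO (tgt H (lift e' (actA \<tau> (map pA hs)))) = tgt G (actA \<tau> (map pA hs))"
proof -
  note l = lift[OF base_ob act_star_base[OF assms]]
  show "lift e' (actA \<tau> (map pA hs)) \<in> star H e'"
    unfolding star_def using l(1,2) by blast
qed (fact lift(3-5)[OF base_ob act_star_base[OF assms]])+

definition path :: "'p \<Rightarrow> 'b" where
  "path x = (SOME h. h \<in> arrows H e' x)"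

lemma path:
  assumes "x \<in> ob H"
  shows "path x \<in> star H e'" "path x \<in> arr H" "src H (path x) = e'" "tgt H (path x) = x"
proof -
  have "path x \<in> arrows H e' x"
    unfolding path_def using reachable[OF assms] by (simp add: some_in_eq)
  then show "path x \<in> star H e'" "path x \<in> arr H" "src H (path x) = e'" "tgt H (path x) = x"
    by (auto simp: arrows_def star_def)
qed

lemma path_tuples: "xs \<in> tuples (ob H) n \<Longrightarrow> map path xs \<in> tuples (star H e') n"
  by (erule tuples_map) (simp add: path)

definition lift_obj_act :: "'m \<Rightarrow> 'p list \<Rightarrow> 'p" where
  "lift_obj_act \<tau> xs = tgt H (lift e' (actA \<tau> (map pA (map path xs))))"

text \<open>The heart of the matter: the value of an operation on objects does not depend on the arrows
  chosen from \<open>e'\<close> to them. Two choices \<open>h\<close> and \<open>k\<close> with the same target differ by the loop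
  \<open>h k\<^sup>-\<^sup>1\<close> at \<open>e'\<close>, whose image lies in the characteristic group, a subalgebra. By interchange the two values of the operation
  on arrows differ by the value on these images, which is again the image of a loop at \<open>e'\<close> and so does
  not change the endpoint of the lift.\<close>

lemma lift_obj_act_tgt:
  assumes \<tau>: "\<tau> \<in> operations T n" and hs: "hs \<in> tuples (star H e') n"
  shows "lift_obj_act \<tau> (map (tgt H) hs) = tgt H (lift e' (actA \<tau> (map pA hs)))"
proof -
  define k where "k h = path (tgt H h)" for h
  define c where "c h = cmp H h (ivs H (k h))" for h
  have elem: "h \<in> arr H \<and> src H h = e'" if "h \<in> set hs" for h
    using that hs by (auto simp: tuples_def star_def)
  have k: "k h \<in> arr H" "src H (k h) = e'" "tgt H (k h) = tgt H h" if "h \<in> set hs" for h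
    using elem[OF that] path[OF H.tgt_ob] by (auto simp: k_def)
  have c: "c h \<in> arr H" "src H (c h) = e'" "tgt H (c h) = e'" "cmp H (c h) (k h) = h"
    if "h \<in> set hs" for h
    using elem[OF that] k[OF that] H.ivs_arr[OF k(1)[OF that]] H.cmp_ivs_cancel_right[of h "k h"]
    by (auto simp: c_def H.cmp_arr)
  let ?C = "actA \<tau> (map (\<lambda>h. pA (c h)) hs)" and ?K = "actA \<tau> (map (\<lambda>h. pA (k h)) hs)"
  have len: "length hs = n"
    using hs by (simp add: tuples_def)
  have images: "map pA hs = map (\<lambda>h. cmp G (pA (c h)) (pA (k h))) hs"
    using c k by (auto simp: pA_cmp[symmetric])
  have split: "actA \<tau> (map pA hs) = cmp G ?C ?K"
    unfolding images by (rule G.act_cmp[OF \<tau> len]) (simp add: c k composable_def pA_arr)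
  have "map (\<lambda>h. pA (c h)) hs \<in> tuples (characteristic_group H pA e') n"
    using c len by (auto simp: tuples_def characteristic_group_def arrows_def)
  then have "?C \<in> characteristic_group H pA e'"
    using char_subalgebra \<tau> by (simp add: subalgebra_def)
  then obtain l where l: "l \<in> arr H" "src H l = e'" "tgt H l = e'" "pA l = ?C"
    by (auto simp: characteristic_group_def arrows_def)
  then have lift_C: "lift e' ?C = l"
    by (intro lift_eqI)
  have ks: "map k hs \<in> tuples (star H e') n"
    using k len by (auto simp: tuples_def star_def)
  have K: "?K \<in> arr G" "src G ?K = pO e'"
    using act_star_base[OF \<tau> ks] by (simp_all add: comp_def)
  have C: "?C \<in> arr G" "src G ?C = pO e'" "tgt G ?C = pO e'"
    using pA_arr[OF l(1)] by (simp_all only: l)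
  have "lift e' (actA \<tau> (map pA hs)) = lift e' (cmp G ?C ?K)"
    by (simp only: split)
  also have "\<dots> = cmp H (lift e' ?C) (lift (tgt H (lift e' ?C)) ?K)"
    by (rule lift_cmp[OF base_ob C(1,2) K(1)]) (simp only: C K)
  also have "\<dots> = cmp H l (lift e' ?K)"
    by (simp only: lift_C l)
  also have "tgt H \<dots> = tgt H (lift e' ?K)"
    by (rule H.cmp_arr(3)[OF l(1) lift(1)[OF base_ob K]]) (simp only: l lift[OF base_ob K])
  finally show ?thesis
    by (simp add: lift_obj_act_def k_def comp_def)
qed

lemma lift_obj_act_ob:
  assumes \<tau>: "\<tau> \<in> operations T n" and xs: "xs \<in> tuples (ob H) n"
  shows "lift_obj_act \<tau> xs \<in> ob H"
  unfolding lift_obj_act_def by (rule lift_star_base(3)[OF \<tau> path_tuples[OF xs]])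

lemma pO_lift_obj_act:
  assumes \<tau>: "\<tau> \<in> operations T n" and xs: "xs \<in> tuples (ob H) n"
  shows "pO (lift_obj_act \<tau> xs) = actO \<tau> (map pO xs)"
proof -
  note hs = path_tuples[OF xs]
  have "pO (lift_obj_act \<tau> xs) = actO \<tau> (map (tgt G) (map pA (map path xs)))"
    unfolding lift_obj_act_def
    using lift_star_base(4)[OF \<tau> hs] G.tgt_act[OF \<tau> star_base_images[OF hs]] by simp
  also have "map (tgt G) (map pA (map path xs)) = map pO xs"
    using xs by (auto simp: tuples_def pA_arr path subset_iff)
  finally show ?thesis .
qed

lemma objects_t_algebra: "t_algebra T (ob H) lift_obj_act"
proof
  show "lift_obj_act \<tau> xs \<in> ob H" if "\<tau> \<in> operations T n" "xs \<in> tuples (ob H) n" for \<tau> n xs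
    using that by (rule lift_obj_act_ob)
next
  fix i n xs assume i: "i < n" and xs: "xs \<in> tuples (ob H) n"
  have len: "length xs = n" and xi: "xs ! i \<in> ob H"
    using xs i by (auto simp: tuples_def)
  have "actA (proj T n i) (map pA (map path xs)) = pA (path (xs ! i))"
    using G.arrows.act_proj[OF i star_base_images[OF path_tuples[OF xs]]] i len by simp
  then show "lift_obj_act (proj T n i) xs = xs ! i"
    using lift_eqI[OF path(2,3)[OF xi] refl] path(4)[OF xi] by (simp add: lift_obj_act_def)
next
  fix \<tau> n f m xs
  assume \<tau>: "\<tau> \<in> operations T n" and f: "f \<in> hom_set T m n" and xs: "xs \<in> tuples (ob H) m"
  note hs = path_tuples[OF xs]
  let ?gs = "map pA (map path xs)"
  let ?f = "\<lambda>i. compose T (proj T n i) f"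
  \<comment> \<open>The arrows used to compute the components of \<open>f\<close> also serve to compute \<open>\<tau>\<close> on them.\<close>
  let ?ks = "map (\<lambda>i. lift e' (actA (?f i) ?gs)) [0..<n]"
  have fi: "?f i \<in> operations T m" if "i < n" for i
    using compose_hom[OF f proj_hom[OF that]] by (simp add: operations_def)
  have ks: "?ks \<in> tuples (star H e') n"
    using lift_star_base(1)[OF fi hs] by (auto simp: tuples_def)
  have "map pA ?ks = map (\<lambda>i. actA (?f i) ?gs) [0..<n]"
    using lift_star_base(2)[OF fi hs] by simp
  then have "actA (compose T \<tau> f) ?gs = actA \<tau> (map pA ?ks)"
    using G.arrows.act_compose[OF \<tau> f star_base_images[OF hs]] by (simp del: map_map)
  then have "lift_obj_act (compose T \<tau> f) xs = lift_obj_act \<tau> (map (tgt H) ?ks)"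
    using lift_obj_act_tgt[OF \<tau> ks] by (simp add: lift_obj_act_def)
  then show "lift_obj_act (compose T \<tau> f) xs = lift_obj_act \<tau> (map (\<lambda>i. lift_obj_act (?f i) xs) [0..<n])"
    by (simp add: lift_obj_act_def comp_def)
qed


section \<open>The algebra of arrows\<close>

definition lift_arr_act :: "'m \<Rightarrow> 'b list \<Rightarrow> 'b" where
  "lift_arr_act \<tau> hs = lift (lift_obj_act \<tau> (map (src H) hs)) (actA \<tau> (map pA hs))"

lemma src_tuples: "hs \<in> tuples (arr H) n \<Longrightarrow> map (src H) hs \<in> tuples (ob H) n"
  by (erule tuples_map) (simp add: H.src_ob)

lemma image_tuples: "hs \<in> tuples (arr H) n \<Longrightarrow> map pA hs \<in> tuples (arr G) n"
  by (erule tuples_map) (simp add: pA_arr)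

lemma lift_arr_act:
  assumes \<tau>: "\<tau> \<in> operations T n" and hs: "hs \<in> tuples (arr H) n"
  shows "lift_arr_act \<tau> hs \<in> arr H"
    "src H (lift_arr_act \<tau> hs) = lift_obj_act \<tau> (map (src H) hs)"
    "pA (lift_arr_act \<tau> hs) = actA \<tau> (map pA hs)"
proof -
  have "map (src G) (map pA hs) = map pO (map (src H) hs)"
    using hs by (auto simp: tuples_def pA_arr)
  then have "src G (actA \<tau> (map pA hs)) = pO (lift_obj_act \<tau> (map (src H) hs))"
    using G.src_act[OF \<tau> image_tuples[OF hs]] pO_lift_obj_act[OF \<tau> src_tuples[OF hs]]
    by (simp del: map_map)
  note l = lift[OF lift_obj_act_ob[OF \<tau> src_tuples[OF hs]]
      G.arrows.act_closed[OF \<tau> image_tuples[OF hs]] this]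
  show "lift_arr_act \<tau> hs \<in> arr H"
    "src H (lift_arr_act \<tau> hs) = lift_obj_act \<tau> (map (src H) hs)"
    "pA (lift_arr_act \<tau> hs) = actA \<tau> (map pA hs)"
    using l by (simp_all add: lift_arr_act_def)
qed

lemma lift_arr_act_eqI:
  assumes "\<tau> \<in> operations T n" "hs \<in> tuples (arr H) n"
    and "h \<in> arr H" "src H h = lift_obj_act \<tau> (map (src H) hs)" "pA h = actA \<tau> (map pA hs)"
  shows "lift_arr_act \<tau> hs = h"
  using assms by (intro arrow_eqI) (simp_all add: lift_arr_act)

text \<open>To compute the operation on the targets of \<open>h\<^sub>1,\<dots>,h\<^sub>n\<close> one may use the arrows from \<open>e'\<close> obtained
  by composing the chosen paths to the sources with the \<open>h\<^sub>i\<close>. Interchange then decomposes the lifted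
  arrow as the one reaching the operation on the sources, followed by \<open>\<tau>(h\<^sub>1,\<dots>,h\<^sub>n)\<close>.\<close>

lemma tgt_lift_arr_act:
  assumes \<tau>: "\<tau> \<in> operations T n" and hs: "hs \<in> tuples (arr H) n"
  shows "tgt H (lift_arr_act \<tau> hs) = lift_obj_act \<tau> (map (tgt H) hs)"
proof -
  define k where "k h = path (src H h)" for h
  have elem: "h \<in> arr H" if "h \<in> set hs" for h
    using that hs by (auto simp: tuples_def)
  have len: "length hs = n"
    using hs by (simp add: tuples_def)
  have k: "k h \<in> arr H" "src H (k h) = e'" "tgt H (k h) = src H h" if "h \<in> set hs" for h
    using path[OF H.src_ob[OF elem[OF that]]] by (auto simp: k_def)
  let ?ps = "map (\<lambda>h. cmp H (k h) h) hs"
  let ?K = "actA \<tau> (map (\<lambda>h. pA (k h)) hs)" and ?M = "actA \<tau> (map pA hs)"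
  have ps: "?ps \<in> tuples (star H e') n"
    using k elem len by (auto simp: tuples_def star_def H.cmp_arr)
  have images: "map pA ?ps = map (\<lambda>h. cmp G (pA (k h)) (pA h)) hs"
    using k elem by (auto simp: pA_cmp)
  have split: "actA \<tau> (map pA ?ps) = cmp G ?K ?M"
    unfolding images by (rule G.act_cmp[OF \<tau> len]) (simp add: k elem composable_def pA_arr)
  have ks: "map k hs \<in> tuples (star H e') n"
    using k len by (auto simp: tuples_def star_def)
  have K: "?K \<in> arr G" "src G ?K = pO e'"
    using act_star_base[OF \<tau> ks] by (simp_all add: comp_def)
  have tgt_K: "tgt H (lift e' ?K) = lift_obj_act \<tau> (map (src H) hs)"
    by (simp add: lift_obj_act_def k_def comp_def)
  note act = lift_arr_act[OF \<tau> hs]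
  have "src G ?M = pO (tgt H (lift e' ?K))"
    using pA_arr(2)[OF act(1)] by (simp only: act tgt_K)
  then have "src G ?M = tgt G ?K"
    by (simp only: lift(5)[OF base_ob K])
  moreover have "?M \<in> arr G"
    by (rule G.arrows.act_closed[OF \<tau> image_tuples[OF hs]])
  ultimately have "lift e' (cmp G ?K ?M) = cmp H (lift e' ?K) (lift (tgt H (lift e' ?K)) ?M)"
    by (intro lift_cmp[OF base_ob K])
  then have "lift e' (actA \<tau> (map pA ?ps)) = cmp H (lift e' ?K) (lift_arr_act \<tau> hs)"
    by (simp only: split tgt_K lift_arr_act_def)
  moreover have "tgt H (cmp H (lift e' ?K) (lift_arr_act \<tau> hs)) = tgt H (lift_arr_act \<tau> hs)"
    by (rule H.cmp_arr(3)[OF lift(1)[OF base_ob K] act(1)]) (simp only: act tgt_K)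
  ultimately have "tgt H (lift_arr_act \<tau> hs) = tgt H (lift e' (actA \<tau> (map pA ?ps)))"
    by simp
  also have "\<dots> = lift_obj_act \<tau> (map (tgt H) ?ps)"
    by (rule lift_obj_act_tgt[OF \<tau> ps, symmetric])
  also have "map (tgt H) ?ps = map (tgt H) hs"
    using k elem by (auto simp: H.cmp_arr)
  finally show ?thesis .
qed

lemma arrows_t_algebra: "t_algebra T (arr H) lift_arr_act"
proof
  show "lift_arr_act \<tau> hs \<in> arr H" if "\<tau> \<in> operations T n" "hs \<in> tuples (arr H) n" for \<tau> n hs
    using that by (rule lift_arr_act)
next
  fix i n hs assume i: "i < n" and hs: "hs \<in> tuples (arr H) n"
  have len: "length hs = n" and hi: "hs ! i \<in> arr H"
    using hs i by (auto simp: tuples_def)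
  show "lift_arr_act (proj T n i) hs = hs ! i"
  proof (rule lift_arr_act_eqI[OF _ hs hi])
    show "proj T n i \<in> operations T n"
      using proj_hom[OF i] by (simp add: operations_def)
    show "src H (hs ! i) = lift_obj_act (proj T n i) (map (src H) hs)"
      using t_algebra.act_proj[OF objects_t_algebra i src_tuples[OF hs]] i len by simp
    show "pA (hs ! i) = actA (proj T n i) (map pA hs)"
      using G.arrows.act_proj[OF i image_tuples[OF hs]] i len by simp
  qed
next
  fix \<tau> n f m hs
  assume \<tau>: "\<tau> \<in> operations T n" and f: "f \<in> hom_set T m n" and hs: "hs \<in> tuples (arr H) m"
  let ?f = "\<lambda>i. compose T (proj T n i) f"
  let ?ks = "map (\<lambda>i. lift_arr_act (?f i) hs) [0..<n]"
  have fi: "?f i \<in> operations T m" if "i < n" for i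
    using compose_hom[OF f proj_hom[OF that]] by (simp add: operations_def)
  note act = lift_arr_act[OF fi hs]
  have ks: "?ks \<in> tuples (arr H) n"
    using act by (auto simp: tuples_def)
  show "lift_arr_act (compose T \<tau> f) hs = lift_arr_act \<tau> ?ks"
  proof (rule lift_arr_act_eqI[OF _ hs])
    show "compose T \<tau> f \<in> operations T m"
      using compose_hom[OF f] \<tau> by (simp add: operations_def)
    show "lift_arr_act \<tau> ?ks \<in> arr H"
      by (rule lift_arr_act[OF \<tau> ks])
    have "map (src H) ?ks = map (\<lambda>i. lift_obj_act (?f i) (map (src H) hs)) [0..<n]"
      using act by simp
    then show "src H (lift_arr_act \<tau> ?ks) = lift_obj_act (compose T \<tau> f) (map (src H) hs)"
      using lift_arr_act(2)[OF \<tau> ks] t_algebra.act_compose[OF objects_t_algebra \<tau> f src_tuples[OF hs]]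
      by (simp del: map_map)
    have "map pA ?ks = map (\<lambda>i. actA (?f i) (map pA hs)) [0..<n]"
      using act by simp
    then show "pA (lift_arr_act \<tau> ?ks) = actA (compose T \<tau> f) (map pA hs)"
      using lift_arr_act(3)[OF \<tau> ks] G.arrows.act_compose[OF \<tau> f image_tuples[OF hs]]
      by (simp del: map_map)
  qed
qed


section \<open>The lifted internal groupoid\<close>

lemma src_homomorphism: "t_homomorphism T (arr H) lift_arr_act (ob H) lift_obj_act (src H)"
  by (auto simp: t_homomorphism_def lift_arr_act H.src_ob)

lemma tgt_homomorphism: "t_homomorphism T (arr H) lift_arr_act (ob H) lift_obj_act (tgt H)"
  by (auto simp: t_homomorphism_def tgt_lift_arr_act H.tgt_ob)

lemma idn_homomorphism: "t_homomorphism T (ob H) lift_obj_act (arr H) lift_arr_act (idn H)"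
  unfolding t_homomorphism_def
proof (intro conjI allI ballI)
  show "idn H ` ob H \<subseteq> arr H"
    by (auto simp: H.idn_arr)
  fix n \<tau> xs assume \<tau>: "\<tau> \<in> operations T n" and xs: "xs \<in> tuples (ob H) n"
  have elem: "x \<in> ob H" if "x \<in> set xs" for x
    using that xs by (auto simp: tuples_def)
  note ob = lift_obj_act_ob[OF \<tau> xs]
  have "map pO xs \<in> tuples (ob G) n"
    by (rule tuples_map[OF xs]) (rule pO_ob)
  then have "pA (idn H (lift_obj_act \<tau> xs)) = actA \<tau> (map (idn G) (map pO xs))"
    using G.idn_act[OF \<tau>] by (simp add: pA_idn ob pO_lift_obj_act[OF \<tau> xs])
  also have "map (idn G) (map pO xs) = map pA (map (idn H) xs)"
    using elem by (simp add: pA_idn)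
  finally have p: "pA (idn H (lift_obj_act \<tau> xs)) = actA \<tau> (map pA (map (idn H) xs))" .
  have s: "map (src H) (map (idn H) xs) = xs"
    using elem by (auto simp: H.idn_arr intro!: map_idI)
  have "map (idn H) xs \<in> tuples (arr H) n"
    by (rule tuples_map[OF xs]) (rule H.idn_arr)
  from lift_arr_act_eqI[OF \<tau> this H.idn_arr(1)[OF ob]]
  show "idn H (lift_obj_act \<tau> xs) = lift_arr_act \<tau> (map (idn H) xs)"
    using p s H.idn_arr(2)[OF ob] by simp
qed

lemma cmp_homomorphism:
  "t_homomorphism T (composable H) (prod_act lift_arr_act lift_arr_act) (arr H) lift_arr_act
    (\<lambda>(g, h). cmp H g h)"
  unfolding t_homomorphism_def
proof (intro conjI allI ballI)
  show "(\<lambda>(g, h). cmp H g h) ` composable H \<subseteq> arr H"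
    by (auto simp: composable_def H.cmp_arr)
  fix n \<tau> zs assume \<tau>: "\<tau> \<in> operations T n" and zs: "zs \<in> tuples (composable H) n"
  have elem: "fst z \<in> arr H \<and> snd z \<in> arr H \<and> tgt H (fst z) = src H (snd z)" if "z \<in> set zs" for z
    using that zs by (auto simp: tuples_def composable_def)
  have len: "length zs = n"
    using zs by (simp add: tuples_def)
  let ?gs = "map fst zs" and ?hs = "map snd zs" and ?cs = "map (\<lambda>z. cmp H (fst z) (snd z)) zs"
  have gs: "?gs \<in> tuples (arr H) n" and hs: "?hs \<in> tuples (arr H) n"
    and cs: "?cs \<in> tuples (arr H) n"
    using elem len by (auto simp: tuples_def H.cmp_arr)
  note g = lift_arr_act[OF \<tau> gs] and h = lift_arr_act[OF \<tau> hs]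
  have "map (tgt H) ?gs = map (src H) ?hs"
    using elem by simp
  then have mid: "tgt H (lift_arr_act \<tau> ?gs) = src H (lift_arr_act \<tau> ?hs)"
    using tgt_lift_arr_act[OF \<tau> gs] h(2) by (simp del: map_map)
  have "lift_arr_act \<tau> ?cs = cmp H (lift_arr_act \<tau> ?gs) (lift_arr_act \<tau> ?hs)"
  proof (rule lift_arr_act_eqI[OF \<tau> cs])
    show "cmp H (lift_arr_act \<tau> ?gs) (lift_arr_act \<tau> ?hs) \<in> arr H"
      by (rule H.cmp_arr[OF g(1) h(1) mid])
    have "map (src H) ?cs = map (src H) ?gs"
      using elem by (simp add: H.cmp_arr)
    then show "src H (cmp H (lift_arr_act \<tau> ?gs) (lift_arr_act \<tau> ?hs))
        = lift_obj_act \<tau> (map (src H) ?cs)"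
      using H.cmp_arr(2)[OF g(1) h(1) mid] g(2) by (simp del: map_map)
    have "pA (cmp H (lift_arr_act \<tau> ?gs) (lift_arr_act \<tau> ?hs))
        = cmp G (actA \<tau> (map (\<lambda>z. pA (fst z)) zs)) (actA \<tau> (map (\<lambda>z. pA (snd z)) zs))"
      using pA_cmp[OF g(1) h(1) mid] g(3) h(3) by (simp add: comp_def)
    also have "\<dots> = actA \<tau> (map (\<lambda>z. cmp G (pA (fst z)) (pA (snd z))) zs)"
      by (rule G.act_cmp[OF \<tau> len, symmetric]) (simp add: elem composable_def pA_arr)
    also have "map (\<lambda>z. cmp G (pA (fst z)) (pA (snd z))) zs = map pA ?cs"
      using elem by (simp add: pA_cmp)
    finally show "pA (cmp H (lift_arr_act \<tau> ?gs) (lift_arr_act \<tau> ?hs)) = actA \<tau> (map pA ?cs)" .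
  qed
  then show "(\<lambda>(g, h). cmp H g h) (prod_act lift_arr_act lift_arr_act \<tau> zs)
      = lift_arr_act \<tau> (map (\<lambda>(g, h). cmp H g h) zs)"
    by (simp add: prod_act_def case_prod_beta')
qed

lemma ivs_homomorphism: "t_homomorphism T (arr H) lift_arr_act (arr H) lift_arr_act (ivs H)"
  unfolding t_homomorphism_def
proof (intro conjI allI ballI)
  show "ivs H ` arr H \<subseteq> arr H"
    by (auto simp: H.ivs_arr)
  fix n \<tau> hs assume \<tau>: "\<tau> \<in> operations T n" and hs: "hs \<in> tuples (arr H) n"
  have elem: "h \<in> arr H" if "h \<in> set hs" for h
    using that hs by (auto simp: tuples_def)
  note act = lift_arr_act[OF \<tau> hs]
  have inverses: "map (ivs H) hs \<in> tuples (arr H) n"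
    by (rule tuples_map[OF hs]) (rule H.ivs_arr)
  have "map (src H) (map (ivs H) hs) = map (tgt H) hs"
    using elem by (simp add: H.ivs_arr)
  then have s: "src H (ivs H (lift_arr_act \<tau> hs)) = lift_obj_act \<tau> (map (src H) (map (ivs H) hs))"
    using H.ivs_arr(2)[OF act(1)] tgt_lift_arr_act[OF \<tau> hs] by (simp del: map_map)
  have "map (ivs G) (map pA hs) = map pA (map (ivs H) hs)"
    using elem by (simp add: pA_ivs)
  then have p: "pA (ivs H (lift_arr_act \<tau> hs)) = actA \<tau> (map pA (map (ivs H) hs))"
    using pA_ivs[OF act(1)] act(3) G.ivs_act[OF \<tau> image_tuples[OF hs]]
    by (simp del: map_map)
  show "ivs H (lift_arr_act \<tau> hs) = lift_arr_act \<tau> (map (ivs H) hs)"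
    by (rule lift_arr_act_eqI[OF \<tau> inverses H.ivs_arr(1)[OF act(1)] s p, symmetric])
qed

lemma lifted_internal_groupoid: "internal_groupoid T H lift_obj_act lift_arr_act"
  by (intro internal_groupoid.intro internal_groupoid_axioms.intro H.groupoid_axioms
      objects_t_algebra arrows_t_algebra src_homomorphism tgt_homomorphism idn_homomorphism
      cmp_homomorphism ivs_homomorphism)

lemma structure_lifts: "structure_lifts T H G actO actA pO pA"
proof -
  have "t_homomorphism T (ob H) lift_obj_act (ob G) actO pO"
    by (auto simp: t_homomorphism_def pO_lift_obj_act pO_ob)
  moreover have "t_homomorphism T (arr H) lift_arr_act (arr G) actA pA"
    by (auto simp: t_homomorphism_def lift_arr_act pA_arr)
  ultimately show ?thesis
    unfolding structure_lifts_def internal_groupoid_morphism_def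
    using lifted_internal_groupoid G.internal_groupoid_axioms morphism by blast
qed

end


section \<open>The lifting theorem\<close>

theorem theorem4p15:
  fixes T :: "'m theory_data"
    and G :: "('o, 'a) groupoid_data"
    and H :: "('p, 'b) groupoid_data"
    and actO :: "'m \<Rightarrow> 'o list \<Rightarrow> 'o" and actA :: "'m \<Rightarrow> 'a list \<Rightarrow> 'a"
    and pO :: "'p \<Rightarrow> 'o" and pA :: "'b \<Rightarrow> 'a"
    and e :: 'm and e' :: 'p
  assumes "semi_abelian_theory T" and "constants T = {e}"
    and "groupoid H" and "transitive_groupoid H"
    and "internal_groupoid T G actO actA" and "transitive_groupoid G"
    and "covering_morphism H G pO pA"
    and "e' \<in> ob H" and "pO e' = actO e []"
    and "subalgebra T actA (characteristic_group H pA e') (object_group G (actO e []))"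
  shows "structure_lifts T H G actO actA pO pA"
proof -
  interpret pointed_covering T G actO actA H pO pA e e'
  proof (intro pointed_covering.intro pointed_covering_axioms.intro)
    show "algebraic_theory T"
      using assms(1) by (rule semi_abelian_theory.axioms(1))
    show "arrows H e' x \<noteq> {}" if "x \<in> ob H" for x
      using assms(4,8) that by (simp add: transitive_groupoid_def)
  qed (fact assms)+
  show ?thesis
    by (rule structure_lifts)
qed

end
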